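(* Consider the median location problem on a graph $G=(V,E)$ with vector-valued edge costs and real-valued demands, where the facility may be located at any point of $G$ (a node or a point in the interior of an edge). For every non-dominated outcome vector $y$ of this problem, there is at least one efficient solution $(x,P)$ with outcome vector $y$ whose location $x$ is a node of $G$. Moreover, if a point in the interior of an edge is efficient, then the whole edge, i.e. all of its interior points and both incident nodes, is efficient as well.
   Context: Let $p\in\mathbb{N}$, $p\ge 2$, and $\mathbb{R}^p_{\geq}=\{y\in\mathbb{R}^p : y_i\ge 0 \text{ for all } i,\ y\neq 0\}$. Let $G=(V,E)$ be a simple, connected, undirected graph with $V=\{v_1,\dots,v_n\}$. Each node $v_i$ has a real demand $w_i\ge 0$, with at least one $w_j>0$. Each edge $e\in E$ has a cost $c(e)\in\mathbb{R}^p_{\geq}$. The preference matrix $A$ is a fixed real $p\times p$ matrix with nonnegative entries and all diagonal entries equal to $1$. A location $x$ is either a node or a point in the interior of an edge $e=[v_i,v_j]$. An interior point, at relative position $\alpha\in(0,1)$, is treated as an artificial node of zero demand that splits $e$ into two edges $[v_i,x]$ and $[x,v_j]$ with costs $\alpha\,c(e)$ and $(1-\alpha)\,c(e)$. A solution $(x,P)$ consists of a location $x$ and a selected family $P=\{P_1,\dots,P_n\}$, where $P_k$ is a path from $x$ to $v_k$ (in the graph with $e$ split at $x$ if $x$ is an interior point of $e$). The cost of a path is the sum of the costs of its edges (zero for the trivial path), and the outcome vector of $(x,P)$ is $f(x,P)=A\sum_{k=1}^n w_k\,c(P_k)\in\mathbb{R}^p$. A solution $(x,P)$ is efficient if there is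 no solution $(x',P')$ with $f(x',P')\le f(x,P)$ componentwise and $f(x',P')\ne f(x,P)$; in this case $f(x,P)$ is called non-dominated. A point $x$ is called efficient if there is an efficient solution $(x,P)$ located at $x$. *)

theory Defs
  imports "HOL-Analysis.Analysis" "Graph_Theory.Graph_Theory"
begin

text \<open>
  Undirected graphs are symmetric digraphs, as in the locale \<^locale>\<open>pair_graph\<close>: an edge
  $[u,v]$ is the pair of arcs $(u,v)$, $(v,u)$. \<open>Interior u v \<alpha>\<close> is the point of $[u,v]$ at
  relative position \<open>\<alpha>\<close> measured from \<open>u\<close>; hence \<open>Interior u v \<alpha>\<close> and
  \<open>Interior v u (1 - \<alpha>)\<close> denote the same point.
\<close>

datatype 'v location = Node 'v | Interior 'v 'v real

definition locations :: "'v pair_pre_digraph \<Rightarrow> 'v location set" where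
  "locations G = Node ` pverts G \<union>
     {Interior u v \<alpha> | u v \<alpha>. (u, v) \<in> parcs G \<and> 0 < \<alpha> \<and> \<alpha> < 1}"

definition node_graph :: "'v pair_pre_digraph \<Rightarrow> 'v location pair_pre_digraph" where
  "node_graph G = \<lparr> pverts = Node ` pverts G, parcs = map_prod Node Node ` parcs G \<rparr>"

text \<open>An interior location is itself used as the artificial node that splits its edge.\<close>

fun split_graph :: "'v pair_pre_digraph \<Rightarrow> 'v location \<Rightarrow> 'v location pair_pre_digraph" where
  "split_graph G (Node _) = node_graph G"
| "split_graph G (Interior u v \<alpha>) = subdivide (node_graph G) (Node u, Node v) (Interior u v \<alpha>)"

text \<open>
  The artificial node \<open>Interior u v \<alpha>\<close> has only the neighbours \<open>Node u\<close> and \<open>Node v\<close>, and a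
  split graph contains at most one artificial node, so the last equation is never used on an arc.
\<close>

fun arc_cost ::
  "('v \<times> 'v \<Rightarrow> real ^ 'p) \<Rightarrow> 'v location \<times> 'v location \<Rightarrow> real ^ 'p" where
  "arc_cost c (Node s, Node t) = c (s, t)"
| "arc_cost c (Node s, Interior u v \<alpha>) = (if s = u then \<alpha> else 1 - \<alpha>) *\<^sub>R c (u, v)"
| "arc_cost c (Interior u v \<alpha>, Node t) = (if t = u then \<alpha> else 1 - \<alpha>) *\<^sub>R c (u, v)"
| "arc_cost c (Interior _ _ _, Interior _ _ _) = 0"

definition path_cost ::
  "('v \<times> 'v \<Rightarrow> real ^ 'p) \<Rightarrow> ('v location \<times> 'v location) awalk \<Rightarrow> real ^ 'p" where
  "path_cost c p = sum_list (map (arc_cost c) p)"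

text \<open>\<open>P v\<close> is the path selected for node \<open>v\<close>; values of \<open>P\<close> outside the node set are irrelevant.\<close>

definition solution ::
  "'v pair_pre_digraph \<Rightarrow> 'v location \<Rightarrow> ('v \<Rightarrow> ('v location \<times> 'v location) awalk) \<Rightarrow> bool" where
  "solution G x P \<longleftrightarrow> x \<in> locations G \<and>
     (\<forall>v\<in>pverts G. pre_digraph.apath (with_proj (split_graph G x)) x (P v) (Node v))"

definition outcome ::
  "'v pair_pre_digraph \<Rightarrow> ('v \<Rightarrow> real) \<Rightarrow> ('v \<times> 'v \<Rightarrow> real ^ 'p) \<Rightarrow> real ^ 'p ^ 'p \<Rightarrow>
   ('v \<Rightarrow> ('v location \<times> 'v location) awalk) \<Rightarrow> real ^ 'p" where
  "outcome G w c A P = A *v (\<Sum>v\<in>pverts G. w v *\<^sub>R path_cost c (P v))"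

definition efficient ::
  "'v pair_pre_digraph \<Rightarrow> ('v \<Rightarrow> real) \<Rightarrow> ('v \<times> 'v \<Rightarrow> real ^ 'p) \<Rightarrow> real ^ 'p ^ 'p \<Rightarrow>
   'v location \<Rightarrow> ('v \<Rightarrow> ('v location \<times> 'v location) awalk) \<Rightarrow> bool" where
  "efficient G w c A x P \<longleftrightarrow> solution G x P \<and>
     \<not> (\<exists>x' P'. solution G x' P' \<and> outcome G w c A P' \<le> outcome G w c A P \<and>
                outcome G w c A P' \<noteq> outcome G w c A P)"

definition nondominated ::
  "'v pair_pre_digraph \<Rightarrow> ('v \<Rightarrow> real) \<Rightarrow> ('v \<times> 'v \<Rightarrow> real ^ 'p) \<Rightarrow> real ^ 'p ^ 'p \<Rightarrow>
   real ^ 'p \<Rightarrow> bool" where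
  "nondominated G w c A y \<longleftrightarrow> (\<exists>x P. efficient G w c A x P \<and> outcome G w c A P = y)"

definition efficient_point ::
  "'v pair_pre_digraph \<Rightarrow> ('v \<Rightarrow> real) \<Rightarrow> ('v \<times> 'v \<Rightarrow> real ^ 'p) \<Rightarrow> real ^ 'p ^ 'p \<Rightarrow>
   'v location \<Rightarrow> bool" where
  "efficient_point G w c A x \<longleftrightarrow> (\<exists>P. efficient G w c A x P)"

end

theory Submission
  imports Defs
begin

text \<open>
  Let \<open>(x, P)\<close> be efficient with \<open>x\<close> at relative position \<open>\<alpha>\<close> of the edge \<open>[u, v]\<close>. Every
  selected path leaves \<open>x\<close> through \<open>u\<close> or through \<open>v\<close> and never uses the edge again
  (\<open>apath_split_graph_iff\<close>). Keep these exits and the rests of the paths, and let the location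
  slide along the edge. At position \<open>\<beta>\<close> the outcome becomes the affine function
  \<open>g \<beta> = g 0 + \<beta> d A c(u,v)\<close>, where \<open>d\<close> is the demand served through \<open>u\<close> minus the
  demand served through \<open>v\<close>. In the interior the value \<open>g \<beta>\<close> is attained by a solution. At the
  two ends some solution has an outcome that is at most \<open>g \<beta>\<close>, since the walk that traverses the
  whole edge can be shortened to a path of no larger cost (\<open>apath_node_relocate\<close>).

  As \<open>A\<close> is nonnegative with unit diagonal, \<open>A c(u,v)\<close> is nonnegative and nonzero. Hence
  \<open>d \<noteq> 0\<close> would let one of the two ends dominate \<open>(x, P)\<close>. So \<open>d = 0\<close>, the function \<open>g\<close> is
  constant, and every point of the closed edge carries a solution with the outcome of \<open>(x, P)\<close>
  (\<open>efficient_slide\<close>). Both claims follow.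
\<close>

section \<open>Split graphs and their paths\<close>

lemma apath_with_proj_iff:
  "pre_digraph.apath (with_proj H) a p b \<longleftrightarrow>
     a \<in> pverts H \<and> set p \<subseteq> parcs H \<and> pcas a p b \<and> distinct (pawalk_verts a p)"
  by (simp add: pre_digraph.apath_def pre_digraph.awalk_def cas_with_proj_eq
      awalk_verts_with_proj_eq)

lemma set_pawalk_verts:
  "pcas a p b \<Longrightarrow> set (pawalk_verts a p) = insert a (fst ` set p \<union> snd ` set p)"
  by (induction p arbitrary: a) auto

text \<open>
  The graph without the edge \<open>[u, v]\<close>, on the same tagged nodes as the split graphs, so that
  its paths occur literally in the split graphs of all points of the edge.
\<close>

definition edge_deleted :: "'v pair_pre_digraph \<Rightarrow> 'v \<Rightarrow> 'v \<Rightarrow> 'v location pair_pre_digraph" where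
  "edge_deleted G u v = \<lparr> pverts = Node ` pverts G,
     parcs = map_prod Node Node ` parcs G - {(Node u, Node v), (Node v, Node u)} \<rparr>"

lemma parcs_split_graph_Interior:
  "parcs (split_graph G (Interior u v \<alpha>)) =
     {(Node u, Interior u v \<alpha>), (Interior u v \<alpha>, Node u),
      (Node v, Interior u v \<alpha>), (Interior u v \<alpha>, Node v)} \<union> parcs (edge_deleted G u v)"
  by (auto simp: subdivide.simps node_graph_def edge_deleted_def)

lemma pverts_split_graph_Interior:
  "pverts (split_graph G (Interior u v \<alpha>)) = insert (Interior u v \<alpha>) (Node ` pverts G)"
  by (auto simp: node_graph_def)

lemma pair_wf_digraph_node_graph:
  "pair_wf_digraph G \<Longrightarrow> pair_wf_digraph (node_graph G)"
  by (force simp: pair_wf_digraph_def node_graph_def)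

lemma apath_split_graph_iff:
  assumes uv: "u \<in> pverts G" "v \<in> pverts G"
  shows "pre_digraph.apath (with_proj (split_graph G (Interior u v \<alpha>))) (Interior u v \<alpha>) p (Node t)
     \<longleftrightarrow> (\<exists>s q. s \<in> {u, v} \<and> p = (Interior u v \<alpha>, Node s) # q \<and>
           pre_digraph.apath (with_proj (edge_deleted G u v)) (Node s) q (Node t))"
    (is "pre_digraph.apath (with_proj ?S) ?x p _ \<longleftrightarrow> ?R")
proof
  assume ap: "pre_digraph.apath (with_proj ?S) ?x p (Node t)"
  then obtain e q where p: "p = e # q"
    by (cases p) (auto simp: apath_with_proj_iff)
  have e: "fst e = ?x" "e \<in> parcs ?S" and q: "set q \<subseteq> parcs ?S" "pcas (snd e) q (Node t)"
    "distinct (pawalk_verts (snd e) q)" "?x \<notin> set (pawalk_verts (snd e) q)"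
    using ap by (auto simp: apath_with_proj_iff p simp del: split_graph.simps)
  obtain s where s: "s \<in> {u, v}" "e = (?x, Node s)"
    using e by (cases e) (auto simp: parcs_split_graph_Interior edge_deleted_def simp del: split_graph.simps)
  have "set q \<subseteq> parcs (edge_deleted G u v)"
    using q by (force simp: set_pawalk_verts parcs_split_graph_Interior simp del: split_graph.simps)
  then show ?R
    using q s p uv by (auto simp: apath_with_proj_iff edge_deleted_def)
next
  assume ?R
  then obtain s q where s: "s \<in> {u, v}" and p: "p = (?x, Node s) # q"
    and q: "set q \<subseteq> parcs (edge_deleted G u v)" "pcas (Node s) q (Node t)"
      "distinct (pawalk_verts (Node s) q)"
    by (auto simp: apath_with_proj_iff)
  have "?x \<notin> set (pawalk_verts (Node s) q)"
    using q by (auto simp: set_pawalk_verts edge_deleted_def)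
  then show "pre_digraph.apath (with_proj ?S) ?x p (Node t)"
    using s q by (auto simp: apath_with_proj_iff p parcs_split_graph_Interior
        pverts_split_graph_Interior simp del: split_graph.simps)
qed

section \<open>Costs of paths\<close>

lemma path_cost_simps [simp]:
  "path_cost c [] = 0"
  "path_cost c (e # p) = arc_cost c e + path_cost c p"
  "path_cost c (p @ q) = path_cost c p + path_cost c q"
  by (simp_all add: path_cost_def)

lemma path_cost_nonneg:
  "(\<And>e. e \<in> set p \<Longrightarrow> 0 \<le> arc_cost c e) \<Longrightarrow> 0 \<le> path_cost c p"
  by (induction p) (auto intro: add_nonneg_nonneg)

text \<open>The cycles that are cut out have nonnegative cost.\<close>

lemma path_cost_awalk_to_apath_le:
  assumes "wf_digraph (with_proj H)" "pre_digraph.awalk (with_proj H) a p b"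
    and nonneg: "\<And>e. e \<in> parcs H \<Longrightarrow> 0 \<le> arc_cost c e"
  shows "path_cost c (wf_digraph.awalk_to_apath (with_proj H) p) \<le> path_cost c p"
proof -
  interpret wf_digraph "with_proj H" by fact
  show ?thesis
    using assms(2)
  proof (induction rule: awalk_to_apath_induct)
    case (path p)
    then show ?case by (subst awalk_to_apath.simps) auto
  next
    case (decomp p q r s)
    have eq: "awalk_to_apath p = awalk_to_apath (q @ s)"
      using decomp step_awalk_to_apath[of _ p _ q r s] by simp
    have pd: "p = q @ r @ s"
      using decomp by (auto elim: awalk_cyc_decompE)
    then have "set r \<subseteq> parcs H"
      using decomp.hyps by (auto simp: awalk_def)
    then have "0 \<le> path_cost c r"
      by (intro path_cost_nonneg nonneg) blast
    then have "path_cost c (q @ s) \<le> path_cost c p"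
      by (simp add: pd)
    then show ?case
      using decomp.IH eq by (metis order_trans)
  qed
qed

text \<open>
  Once the facility is moved to an end \<open>a\<close> of the edge, the paths that used the exit \<open>a\<close> lose
  their first piece, and the other ones have to traverse the whole edge.
\<close>

lemma apath_node_relocate:
  fixes c :: "'v \<times> 'v \<Rightarrow> real ^ 'p"
  assumes wf: "pair_wf_digraph G"
    and arcs: "(u, v) \<in> parcs G" "(v, u) \<in> parcs G"
    and sym: "c (v, u) = c (u, v)"
    and nonneg: "\<And>e. e \<in> parcs G \<Longrightarrow> 0 \<le> c e"
    and a: "a \<in> {u, v}" and s: "s \<in> {u, v}"
    and q: "pre_digraph.apath (with_proj (edge_deleted G u v)) (Node s) q (Node t)"
  shows "\<exists>p. pre_digraph.apath (with_proj (node_graph G)) (Node a) p (Node t) \<and>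
     path_cost c p \<le> (if s = a then 0 else c (u, v)) + path_cost c q"
proof -
  define q' where "q' = (if s = a then q else (Node a, Node s) # q)"
  have wfN: "wf_digraph (with_proj (node_graph G))"
    using pair_wf_digraph_node_graph[OF wf] by (simp add: wf_digraph_wp_iff)
  interpret N: wf_digraph "with_proj (node_graph G)" by fact
  have V: "u \<in> pverts G" "v \<in> pverts G"
    using wf arcs by (auto dest: pair_wf_digraph.in_arcsD1)
  have arcN: "(Node a, Node s) \<in> parcs (node_graph G)" if "s \<noteq> a"
    using a s arcs that by (auto simp: node_graph_def)
  have "pre_digraph.awalk (with_proj (node_graph G)) (Node a) q' (Node t)"
    using q a s V arcN unfolding q'_def
    by (auto simp: apath_with_proj_iff pre_digraph.awalk_def cas_with_proj_eq edge_deleted_def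
        node_graph_def)
  moreover have "0 \<le> arc_cost c e" if "e \<in> parcs (node_graph G)" for e
    using that nonneg by (auto simp: node_graph_def)
  moreover have "path_cost c q' = (if s = a then 0 else c (u, v)) + path_cost c q"
    using a s sym by (auto simp: q'_def)
  ultimately show ?thesis
    using path_cost_awalk_to_apath_le[OF wfN] N.apath_awalk_to_apath by metis
qed

section \<open>Sliding the location along an edge\<close>

text \<open>The point of the closed edge \<open>[u, v]\<close> at relative position \<open>\<beta>\<close> in \<open>[0, 1]\<close>.\<close>

definition edge_point :: "'v \<Rightarrow> 'v \<Rightarrow> real \<Rightarrow> 'v location" where
  "edge_point u v \<beta> = (if \<beta> = 0 then Node u else if \<beta> = 1 then Node v else Interior u v \<beta>)"

lemma matrix_vector_mult_mono:
  fixes A :: "real ^ 'n ^ 'm"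
  assumes "\<And>i j. 0 \<le> A $ i $ j" "x \<le> y"
  shows "A *v x \<le> A *v y"
  using assms by (auto simp: less_eq_vec_def matrix_vector_mult_def intro!: sum_mono mult_left_mono)

lemma solution_slide:
  fixes c :: "'v \<times> 'v \<Rightarrow> real ^ 'p"
  assumes wf: "pair_wf_digraph G"
    and arcs: "(u, v) \<in> parcs G" "(v, u) \<in> parcs G" and "u \<noteq> v"
    and sym: "c (v, u) = c (u, v)"
    and nonneg: "\<And>e. e \<in> parcs G \<Longrightarrow> 0 \<le> c e"
    and s: "\<And>k. k \<in> pverts G \<Longrightarrow> s k \<in> {u, v}"
    and q: "\<And>k. k \<in> pverts G \<Longrightarrow>
          pre_digraph.apath (with_proj (edge_deleted G u v)) (Node (s k)) (q k) (Node k)"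
    and \<beta>: "0 \<le> \<beta>" "\<beta> \<le> 1"
  shows "\<exists>P. solution G (edge_point u v \<beta>) P \<and> (\<forall>k\<in>pverts G.
     path_cost c (P k) \<le> (if s k = u then \<beta> else 1 - \<beta>) *\<^sub>R c (u, v) + path_cost c (q k))"
proof -
  have V: "u \<in> pverts G" "v \<in> pverts G"
    using wf arcs by (auto dest: pair_wf_digraph.in_arcsD1)
  have loc: "edge_point u v \<beta> \<in> locations G"
    using V arcs \<beta> by (auto simp: edge_point_def locations_def)
  have "\<exists>p. pre_digraph.apath (with_proj (split_graph G (edge_point u v \<beta>)))
            (edge_point u v \<beta>) p (Node k) \<and>
          path_cost c p \<le> (if s k = u then \<beta> else 1 - \<beta>) *\<^sub>R c (u, v) + path_cost c (q k)"
    if k: "k \<in> pverts G" for k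
  proof -
    note relocate = apath_node_relocate[OF wf arcs sym nonneg _ s[OF k] q[OF k]]
    consider "\<beta> = 0" | "\<beta> = 1" | "\<beta> \<noteq> 0" "\<beta> \<noteq> 1" by blast
    then show ?thesis
    proof cases
      case 1
      with relocate[of u] show ?thesis by (auto simp: edge_point_def)
    next
      case 2
      with relocate[of v] s[OF k] \<open>u \<noteq> v\<close> show ?thesis by (auto simp: edge_point_def)
    next
      case 3
      let ?p = "(Interior u v \<beta>, Node (s k)) # q k"
      have "pre_digraph.apath (with_proj (split_graph G (Interior u v \<beta>))) (Interior u v \<beta>) ?p (Node k)"
        unfolding apath_split_graph_iff[OF V] using s[OF k] q[OF k] by blast
      then show ?thesis
        using 3 by (intro exI[of _ ?p]) (simp add: edge_point_def del: split_graph.simps)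
    qed
  qed
  then show ?thesis
    unfolding solution_def using loc by metis
qed

lemma efficient_slide:
  fixes c :: "'v \<times> 'v \<Rightarrow> real ^ 'p" and A :: "real ^ 'p ^ 'p"
  assumes wf: "pair_wf_digraph G"
    and arcs: "(u, v) \<in> parcs G" "(v, u) \<in> parcs G" and "u \<noteq> v"
    and w: "\<And>k. k \<in> pverts G \<Longrightarrow> 0 \<le> w k"
    and sym: "c (v, u) = c (u, v)"
    and nonneg: "\<And>e. e \<in> parcs G \<Longrightarrow> 0 \<le> c e" and "c (u, v) \<noteq> 0"
    and A: "\<And>i j. 0 \<le> A $ i $ j" "\<And>i. A $ i $ i = 1"
    and \<alpha>: "0 < \<alpha>" "\<alpha> < 1"
    and eff: "efficient G w c A (Interior u v \<alpha>) P"
    and \<beta>: "0 \<le> \<beta>" "\<beta> \<le> 1"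
  shows "\<exists>P'. efficient G w c A (edge_point u v \<beta>) P' \<and> outcome G w c A P' = outcome G w c A P"
proof -
  have V: "u \<in> pverts G" "v \<in> pverts G"
    using wf arcs by (auto dest: pair_wf_digraph.in_arcsD1)
  have "\<forall>k\<in>pverts G. \<exists>s q. s \<in> {u, v} \<and> P k = (Interior u v \<alpha>, Node s) # q \<and>
           pre_digraph.apath (with_proj (edge_deleted G u v)) (Node s) q (Node k)"
    using eff by (simp add: efficient_def solution_def apath_split_graph_iff[OF V]
        del: split_graph.simps)
  then obtain s q where s: "\<And>k. k \<in> pverts G \<Longrightarrow> s k \<in> {u, v}"
    and P: "\<And>k. k \<in> pverts G \<Longrightarrow> P k = (Interior u v \<alpha>, Node (s k)) # q k"
    and q: "\<And>k. k \<in> pverts G \<Longrightarrow>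
          pre_digraph.apath (with_proj (edge_deleted G u v)) (Node (s k)) (q k) (Node k)"
    by metis
  define g where "g \<gamma> = A *v (\<Sum>k\<in>pverts G. w k *\<^sub>R
     ((if s k = u then \<gamma> else 1 - \<gamma>) *\<^sub>R c (u, v) + path_cost c (q k)))" for \<gamma>
  define d where "d = (\<Sum>k\<in>pverts G. if s k = u then w k else - w k)"
  have g\<alpha>: "outcome G w c A P = g \<alpha>"
    by (simp add: outcome_def g_def P cong: sum.cong)
  have affine: "g \<gamma> = g 0 + (\<gamma> * d) *\<^sub>R (A *v c (u, v))" for \<gamma>
  proof -
    have "(\<Sum>k\<in>pverts G. w k *\<^sub>R ((if s k = u then \<gamma> else 1 - \<gamma>) *\<^sub>R c (u, v) + path_cost c (q k)))
        = (\<Sum>k\<in>pverts G. w k *\<^sub>R ((if s k = u then 0 else 1 - 0) *\<^sub>R c (u, v) + path_cost c (q k)))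
          + (\<gamma> * d) *\<^sub>R c (u, v)"
      unfolding d_def sum_distrib_left scaleR_sum_left sum.distrib[symmetric]
      by (intro sum.cong refl) (simp add: algebra_simps)
    then show ?thesis
      by (simp add: g_def matrix_vector_right_distrib matrix_vector_mult_scaleR)
  qed
  have sol: "\<exists>P'. solution G (edge_point u v \<gamma>) P' \<and> outcome G w c A P' \<le> g \<gamma>"
    if \<gamma>: "0 \<le> \<gamma>" "\<gamma> \<le> 1" for \<gamma>
  proof -
    obtain P' where P': "solution G (edge_point u v \<gamma>) P'" "\<And>k. k \<in> pverts G \<Longrightarrow>
      path_cost c (P' k) \<le> (if s k = u then \<gamma> else 1 - \<gamma>) *\<^sub>R c (u, v) + path_cost c (q k)"
      using solution_slide[OF wf arcs \<open>u \<noteq> v\<close> sym nonneg s q \<gamma>] by blast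
    have "outcome G w c A P' \<le> g \<gamma>"
      unfolding outcome_def g_def
      by (intro matrix_vector_mult_mono A sum_mono scaleR_left_mono P' w)
    with P' show ?thesis by blast
  qed
  have sol_eq: "\<exists>P'. solution G (edge_point u v \<gamma>) P' \<and> outcome G w c A P' = g \<alpha> \<and> g \<alpha> \<le> g \<gamma>"
    if \<gamma>: "0 \<le> \<gamma>" "\<gamma> \<le> 1" "g \<gamma> \<le> g \<alpha>" for \<gamma>
  proof -
    obtain P' where P': "solution G (edge_point u v \<gamma>) P'" "outcome G w c A P' \<le> g \<gamma>"
      using sol[OF \<gamma>(1,2)] by blast
    have "outcome G w c A P' \<le> outcome G w c A P"
      using order_trans[OF P'(2) \<gamma>(3)] by (simp add: g\<alpha>)
    then have "outcome G w c A P' = outcome G w c A P"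
      using eff P'(1) unfolding efficient_def by blast
    with P' show ?thesis
      by (intro exI[of _ P']) (simp add: g\<alpha>)
  qed
  obtain i where i: "c (u, v) $ i > 0"
    using nonneg[OF arcs(1)] \<open>c (u, v) \<noteq> 0\<close>
    by (simp add: less_eq_vec_def vec_eq_iff) (metis order_less_le)
  have Ac: "0 \<le> A *v c (u, v)"
    using matrix_vector_mult_mono[OF A(1) nonneg[OF arcs(1)]] by simp
  have "c (u, v) $ i = A $ i $ i * c (u, v) $ i"
    by (simp add: A(2))
  also have "\<dots> \<le> (\<Sum>j\<in>UNIV. A $ i $ j * c (u, v) $ j)"
    using nonneg[OF arcs(1)] A(1) by (intro member_le_sum) (auto simp: less_eq_vec_def)
  finally have Aci: "0 < (A *v c (u, v)) $ i"
    using i by (simp add: matrix_vector_mult_def)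
  \<comment> \<open>Sliding must not improve the outcome. Comparing with both ends, which lie on different sides
    of \<open>\<alpha>\<close>, forces \<open>d = 0\<close>.\<close>
  have bound: "(\<gamma> - \<alpha>) * d \<ge> 0" if "0 \<le> \<gamma>" "\<gamma> \<le> 1" for \<gamma>
  proof (rule ccontr)
    assume neg: "\<not> 0 \<le> (\<gamma> - \<alpha>) * d"
    have diff: "g \<gamma> = g \<alpha> + ((\<gamma> - \<alpha>) * d) *\<^sub>R (A *v c (u, v))"
      by (simp add: affine[of \<gamma>] affine[of \<alpha>] algebra_simps)
    have "((\<gamma> - \<alpha>) * d) *\<^sub>R (A *v c (u, v)) \<le> 0"
      using neg Ac by (intro scaleR_nonpos_nonneg) auto
    then have "g \<alpha> \<le> g \<gamma>"
      using sol_eq[OF that] by (auto simp: diff)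
    then have "0 \<le> ((\<gamma> - \<alpha>) * d) * (A *v c (u, v)) $ i"
      by (simp add: diff less_eq_vec_def)
    then show False
      using neg Aci by (simp add: zero_le_mult_iff)
  qed
  have "d = 0"
    using bound[of 0] bound[of 1] \<alpha> by (simp add: zero_le_mult_iff mult_le_0_iff)
  then have "g \<beta> = g \<alpha>"
    by (simp add: affine[of \<beta>] affine[of \<alpha>])
  then obtain P' where "solution G (edge_point u v \<beta>) P'" "outcome G w c A P' = outcome G w c A P"
    using sol_eq[OF \<beta>] g\<alpha> by auto
  with eff show ?thesis
    unfolding efficient_def by auto
qed

theorem theorem6:
  fixes G :: "'v pair_pre_digraph"
    and w :: "'v \<Rightarrow> real"
    and c :: "'v \<times> 'v \<Rightarrow> real ^ 'p"
    and A :: "real ^ 'p ^ 'p"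
  assumes "CARD('p) \<ge> 2"
    and "pair_graph G"
    and "Digraph_Component.connected (with_proj G)"
    and "\<And>v. v \<in> pverts G \<Longrightarrow> w v \<ge> 0"
    and "\<exists>v\<in>pverts G. w v > 0"
    and "\<And>u v. (u, v) \<in> parcs G \<Longrightarrow> c (v, u) = c (u, v)"
    and "\<And>e. e \<in> parcs G \<Longrightarrow> (\<forall>i. c e $ i \<ge> 0) \<and> c e \<noteq> 0"
    and "\<And>i j. A $ i $ j \<ge> 0"
    and "\<And>i. A $ i $ i = 1"
  shows "(\<forall>y. nondominated G w c A y \<longrightarrow>
            (\<exists>v\<in>pverts G. \<exists>P. efficient G w c A (Node v) P \<and> outcome G w c A P = y)) \<and>
         (\<forall>u v \<alpha>. Interior u v \<alpha> \<in> locations G \<and> efficient_point G w c A (Interior u v \<alpha>) \<longrightarrow>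
            (\<forall>\<beta>. 0 < \<beta> \<and> \<beta> < 1 \<longrightarrow> efficient_point G w c A (Interior u v \<beta>)) \<and>
            efficient_point G w c A (Node u) \<and> efficient_point G w c A (Node v))"
proof -
  interpret G: pair_graph G by fact
  have slide: "\<exists>P'. efficient G w c A (edge_point u v \<beta>) P' \<and>
      outcome G w c A P' = outcome G w c A P"
    if x: "Interior u v \<alpha> \<in> locations G" and eff: "efficient G w c A (Interior u v \<alpha>) P"
      and \<beta>: "0 \<le> \<beta>" "\<beta> \<le> 1" for u v \<alpha> P \<beta>
  proof -
    have uv: "(u, v) \<in> parcs G" "0 < \<alpha>" "\<alpha> < 1"
      using x by (auto simp: locations_def)
    show ?thesis
    proof (rule efficient_slide[OF _ uv(1) _ _ assms(4) _ _ _ assms(8,9) uv(2,3) eff \<beta>])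
      show "pair_wf_digraph G" by unfold_locales
      show "(v, u) \<in> parcs G" "u \<noteq> v"
        using uv(1) by (auto dest: G.arcs_symmetric G.no_loops')
      show "c (v, u) = c (u, v)" "c (u, v) \<noteq> 0"
        using assms(6,7) uv(1) by auto
      show "0 \<le> c e" if "e \<in> parcs G" for e
        using assms(7)[OF that] by (simp add: less_eq_vec_def)
    qed
  qed
  show ?thesis
  proof (intro conjI allI impI)
    fix y assume "nondominated G w c A y"
    then obtain x P where eff: "efficient G w c A x P" and y: "outcome G w c A P = y"
      by (auto simp: nondominated_def)
    have loc: "x \<in> locations G"
      using eff by (simp add: efficient_def solution_def)
    show "\<exists>v\<in>pverts G. \<exists>P. efficient G w c A (Node v) P \<and> outcome G w c A P = y"
    proof (cases x)
      case (Node v)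
      then have "v \<in> pverts G" using loc by (auto simp: locations_def)
      with eff y Node show ?thesis by blast
    next
      case (Interior u v \<alpha>)
      then have "u \<in> pverts G"
        using loc by (auto simp: locations_def dest: G.in_arcsD1)
      with slide[of u v \<alpha> P 0] eff loc y Interior show ?thesis
        by (auto simp: edge_point_def)
    qed
  next
    fix u v \<alpha> \<beta>
    assume "Interior u v \<alpha> \<in> locations G \<and> efficient_point G w c A (Interior u v \<alpha>)"
    then have point: "efficient_point G w c A (edge_point u v \<gamma>)" if "0 \<le> \<gamma>" "\<gamma> \<le> 1" for \<gamma>
      using slide that unfolding efficient_point_def by blast
    show "efficient_point G w c A (Node u)" "efficient_point G w c A (Node v)"
      using point[of 0] point[of 1] by (simp_all add: edge_point_def)
    show "efficient_point G w c A (Interior u v \<beta>)" if "0 < \<beta> \<and> \<beta> < 1"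
      using point[of \<beta>] that by (simp add: edge_point_def)
  qed
qed

end
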